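(* Let $n,q\ge 2$ be integers. Then \begin{align*} l_q(n)&=2l_q(n-1,n)-l_q(n-1)+\rho_q(n),\\ l_q(n-1,n)&=2l_q(n-1)-l_q(n-2,n-1)+\sigma_q(n), \end{align*} where $l_q(m)=l_q(m,m)$, \[ \rho_q(n)=4\sum_{i=2}^n\bigl(e_{q-1}(i)-2e_q(i)+e_{q+1}(i)\bigr), \] and so $\rho_q(n)-\rho_q(n-1)=4(e_{q-1}(n)-2e_q(n)+e_{q+1}(n))$, and \[ \sigma_q(n)=(n-1)\bigl(e_{q-1}(n)-2e_q(n)+e_{q+1}(n)\bigr). \] The initial values are $l_q(n)=l_q(n-1,n)=0$ for all integers $n$ with $1\le n<q$, and $l_q(q-1,q)=q-1$.
   Context: For integers $n_1,n_2\ge 0$, let $G(n_1,n_2)=\{0,\dots,n_1-1\}\times\{0,\dots,n_2-1\}\subset\mathbb{R}^2$ (empty if $n_1=0$ or $n_2=0$). For an integer $q\ge 2$, $l_q(n_1,n_2)$ denotes the number of lines in $\mathbb{R}^2$ passing through exactly $q$ points of $G(n_1,n_2)$. For integers $n\ge 2$ and $q\ge 1$, \[ e_q(n)=\begin{cases}\phi\bigl(\frac{n-1}{q}\bigr)&\text{if } q\mid n-1,\\ 0&\text{if } q\nmid n-1,\end{cases} \] where $\phi$ is the Euler totient function. Empty sums are $0$, so $\rho_q(1)=0$. *)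

theory Defs
  imports "HOL-Analysis.Analysis" "HOL-Number_Theory.Totient"
begin

definition grid :: "nat \<Rightarrow> nat \<Rightarrow> (real \<times> real) set" where
  "grid n1 n2 = {(real i, real j) | i j. i < n1 \<and> j < n2}"

definition lines_through :: "nat \<Rightarrow> nat \<Rightarrow> nat \<Rightarrow> (real \<times> real) set set" where
  "lines_through q n1 n2 =
     {L. affine L \<and> aff_dim L = 1 \<and> card (L \<inter> grid n1 n2) = q}"

(* Meant for q \<ge> 2: then the set is finite. For q \<le> 1 and a nonempty grid it is infinite,
   so that card yields 0. *)
definition num_lines :: "nat \<Rightarrow> nat \<Rightarrow> nat \<Rightarrow> nat" where
  "num_lines q n1 n2 = card (lines_through q n1 n2)"

abbreviation num_lines_sq :: "nat \<Rightarrow> nat \<Rightarrow> nat" where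
  "num_lines_sq q m \<equiv> num_lines q m m"

(* Meant for q \<ge> 1 and n \<ge> 2. *)
definition e_fun :: "nat \<Rightarrow> nat \<Rightarrow> nat" where
  "e_fun q n = (if q dvd n - 1 then totient ((n - 1) div q) else 0)"

(* Integer-valued, as both can be negative. *)
definition rho_q :: "nat \<Rightarrow> nat \<Rightarrow> int" where
  "rho_q q n = 4 * (\<Sum>i=2..n. int (e_fun (q - 1) i) - 2 * int (e_fun q i) + int (e_fun (q + 1) i))"

definition sigma_q :: "nat \<Rightarrow> nat \<Rightarrow> int" where
  "sigma_q q n = (int n - 1) *
     (int (e_fun (q - 1) n) - 2 * int (e_fun q n) + int (e_fun (q + 1) n))"

end

theory Submission imports Defs begin

text \<open>
  A line with exactly \<open>q \<ge> 2\<close> grid points is determined by its primitive direction \<open>d\<close>, normalised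
  up to sign, and its first grid point \<open>p\<close>: the points \<open>p\<close> and \<open>p + (q - 1) d\<close> lie in the grid while
  \<open>p - d\<close> and \<open>p + q d\<close> do not. For fixed \<open>d = (a, b)\<close>, inclusion-exclusion counts the possible \<open>p\<close> as
  \<open>w (q - 1) - 2 w q + w (q + 1)\<close>, where \<open>w r = max 0 (n1 - r \<bar>a\<bar>) * max 0 (n2 - r \<bar>b\<bar>)\<close> is the number
  of \<open>p\<close> such that \<open>p\<close> and \<open>p + r d\<close> lie in the grid. It remains to take differences of \<open>w r\<close> in
  \<open>(n1, n2)\<close>, summed over all primitive \<open>(a, b)\<close>. In the first recurrence these collapse to the number of
  primitive vectors with \<open>r max(\<bar>a\<bar>, \<bar>b\<bar>) < n\<close>, and in the second, after symmetrising in \<open>a\<close> and \<open>b\<close>, to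
  a sum over the primitive vectors with \<open>r \<bar>b\<bar> = n - 1\<close>; both are totient sums.
\<close>

section \<open>Integer model of the grid, its directions and its lines\<close>

definition cells :: "nat \<Rightarrow> nat \<Rightarrow> (int \<times> int) set" where
  "cells n1 n2 = {0..<int n1} \<times> {0..<int n2}"

definition step :: "int \<times> int \<Rightarrow> int \<times> int \<Rightarrow> int \<Rightarrow> int \<times> int" where
  "step d p j = (fst p + j * fst d, snd p + j * snd d)"

definition to_real2 :: "int \<times> int \<Rightarrow> real \<times> real" where
  "to_real2 p = (of_int (fst p), of_int (snd p))"

definition line :: "int \<times> int \<Rightarrow> int \<times> int \<Rightarrow> (real \<times> real) set" where
  "line d p = range (\<lambda>t. to_real2 p + t *\<^sub>R to_real2 d)"

text \<open>The bound \<open>N\<close> keeps sums over directions finite. It only has to dominate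
  the grid sides, so one \<open>N\<close> can serve several grids at once.\<close>

definition primitive_dirs :: "nat \<Rightarrow> (int \<times> int) set" where
  "primitive_dirs N = {(a, b). \<bar>a\<bar> \<le> int N \<and> \<bar>b\<bar> \<le> int N \<and> coprime a b}"

definition half_dirs :: "nat \<Rightarrow> (int \<times> int) set" where
  "half_dirs N = {(a, b). (a, b) \<in> primitive_dirs N \<and> (a > 0 \<or> (a = 0 \<and> b > 0))}"

definition runs :: "nat \<Rightarrow> nat \<Rightarrow> nat \<Rightarrow> int \<times> int \<Rightarrow> (int \<times> int) set" where
  "runs q n1 n2 d = {p. p \<in> cells n1 n2 \<and> step d p (int q - 1) \<in> cells n1 n2
     \<and> step d p (-1) \<notin> cells n1 n2 \<and> step d p (int q) \<notin> cells n1 n2}"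

text \<open>Side lengths are integers so that shifted sizes such as \<open>n - 2\<close> are genuine
  differences.\<close>

definition weight :: "int \<Rightarrow> int \<Rightarrow> int \<Rightarrow> int \<times> int \<Rightarrow> int" where
  "weight r m1 m2 d = max 0 (m1 - r * \<bar>fst d\<bar>) * max 0 (m2 - r * \<bar>snd d\<bar>)"

definition weight_sum :: "nat \<Rightarrow> int \<Rightarrow> int \<Rightarrow> int \<Rightarrow> int" where
  "weight_sum N r m1 m2 = (\<Sum>d\<in>primitive_dirs N. weight r m1 m2 d)"

section \<open>Lattice points on a line\<close>

lemma step_0 [simp]: "step d p 0 = p"
  by (simp add: step_def)

lemma step_step [simp]: "step d (step d p i) j = step d p (i + j)"
  by (simp add: step_def algebra_simps)

lemma inj_to_real2: "inj to_real2"
  by (auto simp: inj_on_def to_real2_def prod_eq_iff)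

lemma grid_eq_image_cells: "grid n1 n2 = to_real2 ` cells n1 n2"
proof
  show "grid n1 n2 \<subseteq> to_real2 ` cells n1 n2"
  proof
    fix x assume "x \<in> grid n1 n2"
    then obtain i j where "x = (real i, real j)" "i < n1" "j < n2"
      by (auto simp: grid_def)
    then have "x = to_real2 (int i, int j)" "(int i, int j) \<in> cells n1 n2"
      by (auto simp: to_real2_def cells_def)
    then show "x \<in> to_real2 ` cells n1 n2" by blast
  qed
  show "to_real2 ` cells n1 n2 \<subseteq> grid n1 n2"
  proof
    fix x assume "x \<in> to_real2 ` cells n1 n2"
    then obtain i j where "x = (of_int i, of_int j)" "0 \<le> i" "i < int n1" "0 \<le> j" "j < int n2"
      by (auto simp: to_real2_def cells_def)
    then have "x = (real (nat i), real (nat j))" "nat i < n1" "nat j < n2" by auto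
    then show "x \<in> grid n1 n2" unfolding grid_def by blast
  qed
qed

text \<open>The map from \<open>j\<close> to \<open>x + j * a\<close> is monotone, in a direction
  given by the sign of \<open>a\<close>.\<close>

lemma interval_convex_int:
  fixes x a :: int
  assumes "i \<le> j" "j \<le> k" "x + i * a \<in> {0..<n}" "x + k * a \<in> {0..<n}"
  shows "x + j * a \<in> {0..<n}"
proof (cases "a \<ge> 0")
  case True
  then have "i * a \<le> j * a" "j * a \<le> k * a" using assms by (auto intro: mult_right_mono)
  then show ?thesis using assms by auto
next
  case False
  then have "i * a \<ge> j * a" "j * a \<ge> k * a" using assms by (auto intro: mult_right_mono_neg)
  then show ?thesis using assms by auto
qed

lemma cells_convex:
  assumes "step d p i \<in> cells n1 n2" "step d p k \<in> cells n1 n2" "i \<le> j" "j \<le> k"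
  shows "step d p j \<in> cells n1 n2"
  using assms interval_convex_int[of i j k "fst p" "fst d" "int n1"]
    interval_convex_int[of i j k "snd p" "snd d" "int n2"]
  by (auto simp: step_def cells_def)

lemma step_inj:
  assumes "coprime (fst d) (snd d)" "step d p i = step d p j"
  shows "i = j"
  using assms by (cases "fst d = 0") (auto simp: step_def)

lemma step_in_line: "to_real2 (step d p j) \<in> line d p"
  unfolding line_def
  by (rule range_eqI[of _ _ "of_int j"]) (simp add: to_real2_def step_def)

text \<open>By Bezout, an integral real multiple of a primitive vector is an integer multiple.\<close>
lemma in_line_imp_step:
  assumes "coprime (fst d) (snd d)" "to_real2 c \<in> line d p"
  obtains j where "c = step d p j"
proof -
  obtain a b where d: "d = (a, b)" by (cases d)
  obtain t where t: "to_real2 c = to_real2 p + t *\<^sub>R to_real2 d"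
    using assms(2) by (auto simp: line_def)
  then have t1: "of_int (fst c - fst p) = t * of_int a" and t2: "of_int (snd c - snd p) = t * of_int b"
    by (auto simp: to_real2_def d)
  obtain u v where uv: "u * a + v * b = 1"
    using assms(1) bezout_int[of a b] by (auto simp: d)
  define j where "j = u * (fst c - fst p) + v * (snd c - snd p)"
  have "of_int j = of_int u * (t * of_int a) + of_int v * (t * of_int b)"
    unfolding j_def using t1 t2 by simp
  also have "\<dots> = t * of_int (u * a + v * b)" by (simp add: algebra_simps)
  finally have j: "t = of_int j" using uv by simp
  have "fst c - fst p = j * a" "snd c - snd p = j * b"
    using t1 t2 unfolding j of_int_mult[symmetric] of_int_eq_iff by auto
  then have "c = step d p j" by (auto simp: step_def d prod_eq_iff)
  then show ?thesis by (rule that)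
qed

text \<open>On a line with primitive direction the lattice points are exactly the integer steps,
  each reached once, so grid points can be counted by integer parameters.\<close>

lemma card_line_inter_grid:
  assumes "coprime (fst d) (snd d)"
  shows "card (line d p \<inter> grid n1 n2) = card {j. step d p j \<in> cells n1 n2}"
proof -
  have "bij_betw (\<lambda>j. to_real2 (step d p j)) {j. step d p j \<in> cells n1 n2} (line d p \<inter> grid n1 n2)"
  proof (rule bij_betw_imageI)
    show "inj_on (\<lambda>j. to_real2 (step d p j)) {j. step d p j \<in> cells n1 n2}"
      by (intro inj_onI step_inj[OF assms] injD[OF inj_to_real2])
    show "(\<lambda>j. to_real2 (step d p j)) ` {j. step d p j \<in> cells n1 n2} = line d p \<inter> grid n1 n2"
    proof
      show "(\<lambda>j. to_real2 (step d p j)) ` {j. step d p j \<in> cells n1 n2} \<subseteq> line d p \<inter> grid n1 n2"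
        by (auto simp: step_in_line grid_eq_image_cells)
      show "line d p \<inter> grid n1 n2 \<subseteq> (\<lambda>j. to_real2 (step d p j)) ` {j. step d p j \<in> cells n1 n2}"
      proof
        fix x assume x: "x \<in> line d p \<inter> grid n1 n2"
        then obtain c where c: "c \<in> cells n1 n2" "x = to_real2 c" by (auto simp: grid_eq_image_cells)
        then obtain j where "c = step d p j" using x in_line_imp_step[OF assms] by blast
        then show "x \<in> (\<lambda>j. to_real2 (step d p j)) ` {j. step d p j \<in> cells n1 n2}" using c by blast
      qed
    qed
  qed
  then show ?thesis by (simp add: bij_betw_same_card)
qed

text \<open>Moving the base point translates the real parameter by \<open>j\<close>, which permutes
  the reals. This allows rebasing a line at its first grid point.\<close>

lemma line_step: "line d (step d p j) = line d p"
proof -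
  have *: "to_real2 (step d p j) + t *\<^sub>R to_real2 d = to_real2 p + (of_int j + t) *\<^sub>R to_real2 d" for t
    by (simp add: to_real2_def step_def algebra_simps)
  have "range (\<lambda>t. to_real2 p + (of_int j + t) *\<^sub>R to_real2 d) = (\<lambda>t. to_real2 p + t *\<^sub>R to_real2 d) ` range (\<lambda>t. of_int j + t)"
    by (simp only: image_image)
  also have "range (\<lambda>t. of_int j + t) = (UNIV :: real set)" by (rule surj_plus)
  finally show ?thesis unfolding line_def * .
qed

section \<open>Lines as one-dimensional affine sets\<close>

lemma to_real2_0_iff: "to_real2 d = 0 \<longleftrightarrow> d = 0"
  by (auto simp: to_real2_def prod_eq_iff)

lemma line_eq_affine_hull: "line d p = affine hull {to_real2 p, to_real2 p + to_real2 d}"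
  by (simp add: affine_hull_2_alt line_def)

lemma affine_line: "affine (line d p)"
  by (simp add: line_eq_affine_hull)

lemma aff_dim_line: "d \<noteq> 0 \<Longrightarrow> aff_dim (line d p) = 1"
  by (simp add: line_eq_affine_hull aff_dim_2 to_real2_0_iff)

text \<open>As \<open>u\<close> and \<open>v\<close> differ, \<open>g\<close> is nonzero, so
  \<open>u + d\<close> lies on the affine hull of \<open>u\<close> and \<open>v\<close>. Hence
  \<open>line d u\<close> is contained in \<open>L\<close>, and equal dimensions force
  equality.\<close>

lemma affine_dim_1_eq_line:
  assumes L: "affine L" "aff_dim L = 1" and "to_real2 u \<in> L" "to_real2 v \<in> L" "u \<noteq> v"
    and g: "to_real2 v - to_real2 u = g *\<^sub>R to_real2 d"
  shows "L = line d u"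
proof -
  have "g *\<^sub>R to_real2 d \<noteq> 0" using g assms(5) injD[OF inj_to_real2, of u v] by auto
  then have g0: "g \<noteq> 0" and d0: "d \<noteq> 0" by (auto simp: to_real2_0_iff)
  have v: "to_real2 u + to_real2 d = to_real2 u + (1/g) *\<^sub>R (to_real2 v - to_real2 u)"
    using g g0 by simp
  have "to_real2 u + to_real2 d \<in> affine hull {to_real2 u, to_real2 v}"
    unfolding v affine_hull_2_alt by blast
  then have "to_real2 u + to_real2 d \<in> L"
    using hull_minimal[of "{to_real2 u, to_real2 v}" L affine] assms by auto
  then have "line d u \<subseteq> L" unfolding line_eq_affine_hull
    using assms by (intro hull_minimal) auto
  moreover have "line d u \<noteq> {}" by (simp add: line_def)
  ultimately have "line d u = L"
    using affine_dim_equal[OF affine_line L(1)] L(2) aff_dim_line[OF d0] by auto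
  then show ?thesis by simp
qed

section \<open>Lines correspond to pairs of a direction and a run\<close>

lemma finite_cells: "finite (cells n1 n2)"
  by (simp add: cells_def)

lemma half_dirs_coprime: "d \<in> half_dirs N \<Longrightarrow> coprime (fst d) (snd d)"
  by (auto simp: half_dirs_def primitive_dirs_def)

lemma half_dirs_nonzero: "d \<in> half_dirs N \<Longrightarrow> d \<noteq> 0"
  by (auto simp: half_dirs_def prod_eq_iff)

text \<open>By coprimality the cross-product equation makes the first coordinates divide each other;
  the sign normalisation turns this into equality.\<close>

lemma half_dirs_eqI:
  assumes "d \<in> half_dirs N" "d' \<in> half_dirs N" "fst d * snd d' = snd d * fst d'"
  shows "d = d'"
proof -
  obtain a b a' b' where d: "d = (a, b)" "d' = (a', b')" by (cases d, cases d')
  have eq: "a * b' = b * a'" using assms d by simp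
  have c: "coprime a b" "coprime a' b'" using half_dirs_coprime assms d by fastforce+
  have h: "a > 0 \<or> (a = 0 \<and> b > 0)" "a' > 0 \<or> (a' = 0 \<and> b' > 0)"
    using assms d by (auto simp: half_dirs_def)
  have "a dvd a'" using c eq by (metis coprime_dvd_mult_right_iff dvd_triv_left)
  moreover have "a' dvd a" using c eq by (metis coprime_dvd_mult_left_iff dvd_triv_right)
  ultimately have "a = a'" using h
    by (metis dvd_0_left_iff less_le zdvd_antisym_nonneg)
  moreover have "b = b'"
  proof (cases "a = 0")
    case True then show ?thesis using c h \<open>a = a'\<close> by auto
  next
    case False then show ?thesis using eq \<open>a = a'\<close> by auto
  qed
  ultimately show ?thesis using d by simp
qed

text \<open>The points \<open>p\<close> and \<open>p + d\<close> both lie on the second line, so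
  their difference \<open>d\<close> is a real multiple of \<open>d'\<close>.\<close>

lemma line_eq_imp_parallel:
  assumes "line d p = line d' p'"
  shows "fst d * snd d' = snd d * fst d'"
proof -
  obtain s where s: "to_real2 p = to_real2 p' + s *\<^sub>R to_real2 d'"
    using step_in_line[of d p 0] assms by (auto simp: line_def)
  obtain t where t: "to_real2 (step d p 1) = to_real2 p' + t *\<^sub>R to_real2 d'"
    using step_in_line[of d p 1] assms by (auto simp: line_def)
  have "of_int (fst d) = (t - s) * of_int (fst d')" "of_int (snd d) = (t - s) * of_int (snd d')"
    using s t by (auto simp: to_real2_def step_def algebra_simps)
  then have "real_of_int (fst d * snd d') = of_int (snd d * fst d')"
    by simp
  then show ?thesis by (simp only: of_int_eq_iff)
qed

text \<open>Convexity makes the grid points on a line consecutive, so only one of them can have its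
  predecessor outside the grid.\<close>

lemma run_start_unique:
  assumes "p \<in> cells n1 n2" "step d p (-1) \<notin> cells n1 n2"
    and "step d p j \<in> cells n1 n2" "step d (step d p j) (-1) \<notin> cells n1 n2"
  shows "j = 0"
proof (rule ccontr)
  assume "j \<noteq> 0"
  then consider "j \<ge> 1" | "j \<le> -1" by linarith
  then show False
  proof cases
    case 1
    then show False using assms cells_convex[of d p 0 n1 n2 j "j - 1"] by simp
  next
    case 2
    then show False using assms cells_convex[of d p j n1 n2 0 "-1"] by simp
  qed
qed

text \<open>Equal lines have parallel, hence equal, normalised directions; the start points then
  agree because a run has only one start.\<close>

lemma inj_on_line:
  assumes "q \<ge> 1"
  shows "inj_on (\<lambda>(d, p). line d p) (Sigma (half_dirs N) (runs q n1 n2))"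
proof (rule inj_onI, clarsimp)
  fix a b x y a' b' x' y'
  assume d: "(a, b) \<in> half_dirs N" "(a', b') \<in> half_dirs N"
    and p: "(x, y) \<in> runs q n1 n2 (a, b)" "(x', y') \<in> runs q n1 n2 (a', b')"
    and eq: "line (a, b) (x, y) = line (a', b') (x', y')"
  have dd: "(a', b') = (a, b)"
    using half_dirs_eqI[OF d line_eq_imp_parallel[OF eq]] by simp
  have "to_real2 (x', y') \<in> line (a, b) (x, y)"
    unfolding eq using step_in_line[of "(a', b')" "(x', y')" 0] by simp
  then obtain j where j: "(x', y') = step (a, b) (x, y) j"
    using in_line_imp_step half_dirs_coprime[OF d(1)] by blast
  have "j = 0"
    using p run_start_unique[of "(x, y)" n1 n2 "(a, b)" j] unfolding dd j by (simp add: runs_def)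
  then show "a = a' \<and> b = b' \<and> x = x' \<and> y = y'" using dd j by simp
qed

lemma int_convex_eq_interval:
  fixes J :: "int set"
  assumes "finite J" "J \<noteq> {}" "\<And>i j k. i \<in> J \<Longrightarrow> k \<in> J \<Longrightarrow> i \<le> j \<Longrightarrow> j \<le> k \<Longrightarrow> j \<in> J"
  shows "J = {Min J..Max J}"
proof
  show "J \<subseteq> {Min J..Max J}" using assms(1) by (simp add: subset_iff)
  show "{Min J..Max J} \<subseteq> J"
  proof
    fix j assume "j \<in> {Min J..Max J}"
    then show "j \<in> J"
      using assms(3)[OF Min_in[OF assms(1,2)] Max_in[OF assms(1,2)]] by simp
  qed
qed

lemma line_run_in_lines_through:
  assumes "q \<ge> 1" "d \<in> half_dirs N" "p \<in> runs q n1 n2 d"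
  shows "line d p \<in> lines_through q n1 n2"
proof -
  let ?C = "cells n1 n2"
  have p: "step d p 0 \<in> ?C" "step d p (int q - 1) \<in> ?C" "step d p (-1) \<notin> ?C" "step d p (int q) \<notin> ?C"
    using assms by (auto simp: runs_def)
  \<comment> \<open>By convexity, a grid point beyond either end would force the excluded point at
    \<open>-1\<close> or at \<open>q\<close> into the grid.\<close>
  have "{j. step d p j \<in> ?C} = {0..int q - 1}"
  proof safe
    fix j assume j: "step d p j \<in> ?C"
    show "j \<in> {0..int q - 1}"
    proof (rule ccontr)
      assume "j \<notin> {0..int q - 1}"
      then consider "j \<le> -1" | "j \<ge> int q" by force
      then show False
        using cells_convex[OF j p(1), of "-1"] cells_convex[OF p(1) j, of "int q"] p by cases auto
    qed
  next
    fix j assume "j \<in> {0..int q - 1}"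
    then show "step d p j \<in> ?C" using cells_convex[OF p(1,2)] by auto
  qed
  then have "card (line d p \<inter> grid n1 n2) = q"
    using assms by (simp add: card_line_inter_grid[OF half_dirs_coprime[OF assms(2)]])
  then show ?thesis
    using affine_line aff_dim_line[OF half_dirs_nonzero[OF assms(2)]] by (simp add: lines_through_def)
qed

text \<open>Divide by the gcd \<open>h\<close> and let a sign \<open>s\<close> normalise the
  quotient; \<open>s * s = 1\<close> moves the sign into \<open>g\<close>. The size bounds keep
  \<open>d\<close> within the range of \<open>half_dirs\<close>.\<close>

lemma primitive_direction:
  fixes a b :: int
  assumes "(a, b) \<noteq> 0"
  obtains d g where "coprime (fst d) (snd d)" "fst d > 0 \<or> (fst d = 0 \<and> snd d > 0)"
    "a = g * fst d" "b = g * snd d" "\<bar>fst d\<bar> \<le> \<bar>a\<bar>" "\<bar>snd d\<bar> \<le> \<bar>b\<bar>"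
proof -
  define h where "h = gcd a b"
  have h: "h > 0" using assms by (auto simp: h_def prod_eq_iff)
  obtain a' b' where ab: "a = h * a'" "b = h * b'" "coprime a' b'"
    using gcd_coprime_exists[of a b] h unfolding h_def by (metis mult.commute order_less_irrefl)
  define s :: int where "s = (if a' > 0 \<or> (a' = 0 \<and> b' > 0) then 1 else -1)"
  have s: "s * s = 1" "\<bar>s\<bar> = 1" by (auto simp: s_def)
  have le: "\<bar>x\<bar> \<le> \<bar>h * x\<bar>" for x :: int
    using h mult_right_mono[of 1 h "\<bar>x\<bar>"] by (simp add: abs_mult)
  show ?thesis
  proof (rule that[of "(s * a', s * b')" "h * s"])
    show "coprime (fst (s * a', s * b')) (snd (s * a', s * b'))" using ab by (auto simp: s_def)
    show "fst (s * a', s * b') > 0 \<or> (fst (s * a', s * b') = 0 \<and> snd (s * a', s * b') > 0)"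
      using ab by (auto simp: s_def)
  qed (use ab s le in \<open>auto simp: s_def abs_mult\<close>)
qed

text \<open>As \<open>q \<ge> 2\<close>, the line contains two grid points, whose difference gives
  \<open>d\<close>. The parameters of its grid points form an integer interval of \<open>q\<close>
  elements, and the least one, \<open>m\<close>, marks the start of the run.\<close>

lemma lines_through_is_run:
  assumes "q \<ge> 2" "n1 \<le> N" "n2 \<le> N" "L \<in> lines_through q n1 n2"
  obtains d p where "d \<in> half_dirs N" "p \<in> runs q n1 n2 d" "L = line d p"
proof -
  let ?C = "cells n1 n2"
  have L: "affine L" "aff_dim L = 1" "card (L \<inter> grid n1 n2) = q"
    using assms by (auto simp: lines_through_def)
  have "finite (L \<inter> grid n1 n2)" by (simp add: grid_eq_image_cells finite_cells)
  then have "\<exists>x\<in>L \<inter> grid n1 n2. \<exists>y\<in>L \<inter> grid n1 n2. x \<noteq> y"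
    using L(3) assms(1) card_le_Suc0_iff_eq[of "L \<inter> grid n1 n2"] by fastforce
  then obtain u v where uv: "u \<in> ?C" "v \<in> ?C" "to_real2 u \<in> L" "to_real2 v \<in> L" "u \<noteq> v"
    unfolding grid_eq_image_cells by blast
  have nz: "(fst v - fst u, snd v - snd u) \<noteq> 0" using uv by (auto simp: prod_eq_iff)
  obtain d g where d: "coprime (fst d) (snd d)" "fst d > 0 \<or> (fst d = 0 \<and> snd d > 0)"
    "fst v - fst u = g * fst d" "snd v - snd u = g * snd d"
    "\<bar>fst d\<bar> \<le> \<bar>fst v - fst u\<bar>" "\<bar>snd d\<bar> \<le> \<bar>snd v - snd u\<bar>"
    using primitive_direction[OF nz] by blast
  have "\<bar>fst v - fst u\<bar> \<le> int N" "\<bar>snd v - snd u\<bar> \<le> int N"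
    using uv assms by (auto simp: cells_def)
  then have dN: "d \<in> half_dirs N" using d
    by (cases d) (auto simp: half_dirs_def primitive_dirs_def)
  have "to_real2 v - to_real2 u = of_int g *\<^sub>R to_real2 d"
    using d(3,4) by (simp add: to_real2_def flip: of_int_diff of_int_mult)
  then have Lu: "L = line d u" using affine_dim_1_eq_line L uv by blast
  define J where "J = {j. step d u j \<in> ?C}"
  have cJ: "card J = q" using L(3) card_line_inter_grid[OF d(1)] unfolding Lu J_def by simp
  then have fJ: "finite J" "J \<noteq> {}" using assms(1) by (auto intro: card_ge_0_finite)
  have J: "J = {Min J..Max J}"
    by (rule int_convex_eq_interval[OF fJ]) (auto simp: J_def intro: cells_convex)
  define m where "m = Min J"
  have "Max J = m + int q - 1"
  proof -
    have "m \<le> Max J" using fJ by (simp add: m_def)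
    moreover have "card J = nat (Max J - m + 1)" using arg_cong[OF J, of card] by (simp add: m_def)
    ultimately show ?thesis using cJ by simp
  qed
  then have J': "J = {m..m + int q - 1}" using J m_def by simp
  have mem: "step d u j \<in> ?C \<longleftrightarrow> m \<le> j \<and> j \<le> m + int q - 1" for j
    using J' unfolding J_def by (auto simp: set_eq_iff)
  have "step d u m \<in> runs q n1 n2 d"
    using assms(1) by (simp add: runs_def mem)
  then show ?thesis using that[OF dN] Lu line_step by metis
qed

lemma num_lines_eq_sum_runs:
  assumes "q \<ge> 2" "n1 \<le> N" "n2 \<le> N"
  shows "num_lines q n1 n2 = (\<Sum>d\<in>half_dirs N. card (runs q n1 n2 d))"
proof -
  have "bij_betw (\<lambda>(d, p). line d p) (Sigma (half_dirs N) (runs q n1 n2)) (lines_through q n1 n2)"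
  proof (rule bij_betw_imageI)
    show "inj_on (\<lambda>(d, p). line d p) (Sigma (half_dirs N) (runs q n1 n2))"
      using assms by (intro inj_on_line) simp
    show "(\<lambda>(d, p). line d p) ` Sigma (half_dirs N) (runs q n1 n2) = lines_through q n1 n2"
      using assms line_run_in_lines_through[of q _ N _ n1 n2]
      by (force elim: lines_through_is_run[OF assms])
  qed
  then have "num_lines q n1 n2 = card (Sigma (half_dirs N) (runs q n1 n2))"
    by (simp add: num_lines_def bij_betw_same_card)
  moreover have "half_dirs N \<subseteq> {-int N..int N} \<times> {-int N..int N}"
    by (auto simp: half_dirs_def primitive_dirs_def)
  then have "finite (half_dirs N)" by (rule finite_subset) simp
  moreover have "finite (runs q n1 n2 d)" for d
    by (rule finite_subset[OF _ finite_cells[of n1 n2]]) (auto simp: runs_def)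
  ultimately show ?thesis by simp
qed

section \<open>Counting runs in a fixed direction\<close>

lemma card_shift_inter_int:
  fixes n s t :: int
  assumes "n \<ge> 0"
  shows "int (card {x. x + s \<in> {0..<n} \<and> x + t \<in> {0..<n}}) = max 0 (n - \<bar>t - s\<bar>)"
proof -
  have "{x. x + s \<in> {0..<n} \<and> x + t \<in> {0..<n}} = {max (-s) (-t)..<n + min (-s) (-t)}"
    by auto
  then show ?thesis by (simp add: max_def min_def)
qed

text \<open>The two coordinates are constrained independently, so the set is a product of two
  overlaps of shifted intervals.\<close>

lemma card_two_steps:
  assumes "i \<le> k"
  shows "int (card {p. step d p i \<in> cells n1 n2 \<and> step d p k \<in> cells n1 n2})
       = weight (k - i) (int n1) (int n2) d"
proof -
  have "{p. step d p i \<in> cells n1 n2 \<and> step d p k \<in> cells n1 n2}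
      = {x. x + i * fst d \<in> {0..<int n1} \<and> x + k * fst d \<in> {0..<int n1}}
      \<times> {x. x + i * snd d \<in> {0..<int n2} \<and> x + k * snd d \<in> {0..<int n2}}"
    by (auto simp: step_def cells_def)
  moreover have "\<bar>k * x - i * x\<bar> = (k - i) * \<bar>x\<bar>" for x
    using assms by (simp add: abs_mult flip: left_diff_distrib)
  ultimately show ?thesis
    by (simp only: card_cartesian_product of_nat_mult card_shift_inter_int weight_def of_nat_0_le_iff)
qed

lemma card_runs:
  assumes "q \<ge> 1"
  shows "int (card (runs q n1 n2 d)) = weight (int q - 1) (int n1) (int n2) d
    - 2 * weight (int q) (int n1) (int n2) d + weight (int q + 1) (int n1) (int n2) d"
proof -
  let ?C = "cells n1 n2"
  \<comment> \<open>By convexity \<open>B i k\<close> shrinks as the range from \<open>i\<close> to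
    \<open>k\<close> grows. Runs are \<open>B 0 (q - 1)\<close> without
    \<open>B (-1) (q - 1)\<close> and \<open>B 0 q\<close>, which meet in \<open>B (-1) q\<close>;
    the range lengths \<open>q - 1\<close>, \<open>q\<close>, \<open>q\<close>, \<open>q + 1\<close>
    give the coefficients 1, -2, 1.\<close>
  define B where "B i k = {p. step d p i \<in> ?C \<and> step d p k \<in> ?C}" for i k
  have fin: "finite (B 0 k)" for k
    by (rule finite_subset[OF _ finite_cells[of n1 n2]]) (auto simp: B_def)
  have mono: "B i k \<subseteq> B i' k'" if "i \<le> i'" "i' \<le> k'" "k' \<le> k" for i i' k k'
  proof
    fix p assume "p \<in> B i k"
    then show "p \<in> B i' k'"
      using that cells_convex[of d p i n1 n2 k i'] cells_convex[of d p i n1 n2 k k']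
      by (simp add: B_def)
  qed
  have sub: "B (-1) (int q - 1) \<subseteq> B 0 (int q - 1)" "B 0 (int q) \<subseteq> B 0 (int q - 1)"
    using assms by (intro mono; simp)+
  have "B (-1) (int q - 1) \<inter> B 0 (int q) \<subseteq> B (-1) (int q)"
    unfolding B_def by blast
  moreover have "B (-1) (int q) \<subseteq> B (-1) (int q - 1) \<inter> B 0 (int q)"
    using assms by (intro Int_greatest mono; simp)
  ultimately have inter: "B (-1) (int q - 1) \<inter> B 0 (int q) = B (-1) (int q)" by blast
  have "runs q n1 n2 d = B 0 (int q - 1) - (B (-1) (int q - 1) \<union> B 0 (int q))"
    using assms by (auto simp: B_def runs_def)
  moreover have "finite (B (-1) (int q - 1))" using sub fin finite_subset by blast
  ultimately have "int (card (runs q n1 n2 d)) = int (card (B 0 (int q - 1)))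
      - int (card (B (-1) (int q - 1) \<union> B 0 (int q)))"
    using sub fin by (simp add: card_Diff_subset of_nat_diff card_mono)
  moreover have "int (card (B (-1) (int q - 1) \<union> B 0 (int q))) + int (card (B (-1) (int q)))
     = int (card (B (-1) (int q - 1))) + int (card (B 0 (int q)))"
    using card_Un_Int[of "B (-1) (int q - 1)" "B 0 (int q)"] fin \<open>finite (B (-1) (int q - 1))\<close>
    by (simp add: inter)
  moreover have "i \<le> k \<Longrightarrow> int (card (B i k)) = weight (k - i) (int n1) (int n2) d" for i k
    unfolding B_def by (rule card_two_steps)
  ultimately show ?thesis using assms by (simp add: add.commute)
qed

section \<open>Sums over all primitive vectors\<close>

lemma finite_primitive_dirs: "finite (primitive_dirs N)"
  by (rule finite_subset[of _ "{-int N..int N} \<times> {-int N..int N}"])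
    (auto simp: primitive_dirs_def)

text \<open>The primitive vectors are the disjoint union of \<open>half_dirs N\<close> and its
  negative. The full set has the coordinate symmetry that the half lacks.\<close>

lemma sum_primitive_dirs_even:
  fixes f :: "int \<times> int \<Rightarrow> int"
  assumes "\<And>a b. f (- a, - b) = f (a, b)"
  shows "(\<Sum>d\<in>primitive_dirs N. f d) = 2 * (\<Sum>d\<in>half_dirs N. f d)"
proof -
  let ?n = "\<lambda>(a::int, b::int). (- a, - b)"
  have H: "half_dirs N \<subseteq> primitive_dirs N" by (auto simp: half_dirs_def)
  have eq: "primitive_dirs N = half_dirs N \<union> ?n ` half_dirs N"
  proof (rule set_eqI, clarify)
    fix a b
    have "(a, b) \<in> ?n ` half_dirs N \<longleftrightarrow> (- a, - b) \<in> half_dirs N" by force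
    then show "(a, b) \<in> primitive_dirs N \<longleftrightarrow> (a, b) \<in> half_dirs N \<union> ?n ` half_dirs N"
      by (auto simp: half_dirs_def primitive_dirs_def)
  qed
  have disj: "half_dirs N \<inter> ?n ` half_dirs N = {}" by (auto simp: half_dirs_def)
  have fin: "finite (half_dirs N)" using H finite_primitive_dirs finite_subset by blast
  have "inj_on ?n (half_dirs N)" by (auto simp: inj_on_def)
  then have "sum f (?n ` half_dirs N) = (\<Sum>d\<in>half_dirs N. f d)"
    using assms by (subst sum.reindex) (auto intro: sum.cong)
  then show ?thesis unfolding eq using fin disj by (simp add: sum.union_disjoint)
qed

text \<open>Each line is counted for \<open>d\<close> and for \<open>-d\<close>; the factor 2 stays
  on the left to avoid division.\<close>

lemma two_num_lines:
  assumes "q \<ge> 2" "n1 \<le> N" "n2 \<le> N"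
  shows "2 * int (num_lines q n1 n2) = weight_sum N (int (q - 1)) (int n1) (int n2)
    - 2 * weight_sum N (int q) (int n1) (int n2) + weight_sum N (int (q + 1)) (int n1) (int n2)"
proof -
  have "weight_sum N r m1 m2 = 2 * (\<Sum>d\<in>half_dirs N. weight r m1 m2 d)" for r m1 m2
    unfolding weight_sum_def by (rule sum_primitive_dirs_even) (simp add: weight_def)
  moreover have "int (num_lines q n1 n2) = (\<Sum>d\<in>half_dirs N. weight (int q - 1) (int n1) (int n2) d
    - 2 * weight (int q) (int n1) (int n2) d + weight (int q + 1) (int n1) (int n2) d)"
    using assms by (simp add: num_lines_eq_sum_runs[OF assms] card_runs)
  ultimately show ?thesis using assms(1)
    by (simp add: sum.distrib sum_subtractf sum_distrib_left of_nat_diff add.commute)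
qed

lemma primitive_dirs_swap:
  "(\<Sum>d\<in>primitive_dirs N. f (snd d, fst d)) = (\<Sum>d\<in>primitive_dirs N. f d)"
  by (rule sum.reindex_bij_witness[where i = "\<lambda>d. (snd d, fst d)" and j = "\<lambda>d. (snd d, fst d)"])
    (auto simp: primitive_dirs_def coprime_commute)

lemma weight_sum_commute: "weight_sum N r m1 m2 = weight_sum N r m2 m1"
  unfolding weight_sum_def primitive_dirs_swap[of "weight r m2 m1", symmetric]
  by (simp add: weight_def mult.commute)

section \<open>Totient counts on the boundary of a square\<close>

text \<open>Coordinates of the primitive vectors along one side of the square of radius
  \<open>m\<close>. The half-open window assigns each corner to one side; corners are primitive only
  for \<open>m = 1\<close>.\<close>

definition two_periods :: "nat \<Rightarrow> int set" where
  "two_periods m = {a. - int m < a \<and> a \<le> int m \<and> coprime a (int m)}"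

text \<open>Coprimality to \<open>m\<close> has period \<open>m\<close>, so the window consists of
  the totatives and their translates by \<open>-m\<close>.\<close>

lemma sum_two_periods:
  "sum f (two_periods m) = (\<Sum>k\<in>totatives m. f (int k) + f (int k - int m))"
proof -
  have "coprime a (int m) \<Longrightarrow> 0 < a \<Longrightarrow> a \<le> int m \<Longrightarrow> a \<in> int ` totatives m" for a
    by (rule image_eqI[of _ _ "nat a"]) (auto simp: totatives_def simp flip: coprime_int_iff)
  moreover have "a \<in> (\<lambda>k. int k - int m) ` totatives m"
    if "coprime a (int m)" "- int m < a" "a \<le> 0" for a
  proof (rule image_eqI)
    show "a = int (nat (a + int m)) - int m" using that by simp
    have "coprime (a + int m) (int m)" using that(1) by (simp only: coprime_iff_gcd_eq_1 gcd_add1)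
    then show "nat (a + int m) \<in> totatives m" using that
      by (auto simp: totatives_def simp flip: coprime_int_iff)
  qed
  moreover have "coprime (int k - int m) (int m)" if "k \<in> totatives m" for k
  proof -
    have "coprime (int k) (int m)" using that by (simp add: totatives_def)
    then show ?thesis by (simp only: coprime_iff_gcd_eq_1 gcd_diff1)
  qed
  ultimately have "two_periods m = int ` totatives m \<union> (\<lambda>k. int k - int m) ` totatives m"
    by (force simp: two_periods_def totatives_def)
  moreover have "int ` totatives m \<inter> (\<lambda>k. int k - int m) ` totatives m = {}"
    by (force simp: totatives_def)
  ultimately show ?thesis
    by (simp add: sum.union_disjoint sum.reindex inj_on_def sum.distrib)
qed

lemma card_two_periods: "card (two_periods m) = 2 * totient m"
  using sum_two_periods[of "\<lambda>_. 1 :: nat" m] by (simp add: totient_def)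

text \<open>The points \<open>k\<close> and \<open>k - m\<close> together contribute
  \<open>(m - k) + k = m\<close>.\<close>

lemma sum_two_periods_dist: "(\<Sum>a\<in>two_periods m. int m - \<bar>a\<bar>) = int m * int (totient m)"
proof -
  have "(\<Sum>a\<in>two_periods m. int m - \<bar>a\<bar>) = (\<Sum>k\<in>totatives m. int m)"
    unfolding sum_two_periods by (rule sum.cong) (auto simp: totatives_def)
  then show ?thesis by (simp add: totient_def)
qed

lemma finite_two_periods: "finite (two_periods m)"
  by (rule finite_subset[of _ "{- int m..int m}"]) (auto simp: two_periods_def)

text \<open>The boundary of the square splits into four half-open sides, permuted by rotation.\<close>
lemma card_primitive_dirs_boundary:
  assumes "m \<ge> 1" "m \<le> N"
  shows "card {d \<in> primitive_dirs N. max \<bar>fst d\<bar> \<bar>snd d\<bar> = int m} = 8 * totient m"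
proof -
  let ?R = "two_periods m"
  let ?s1 = "\<lambda>a. (a, int m)" and ?s2 = "\<lambda>a. (int m, - a)"
    and ?s3 = "\<lambda>a. (- a, - int m)" and ?s4 = "\<lambda>a. (- int m, a)"
  have "{d \<in> primitive_dirs N. max \<bar>fst d\<bar> \<bar>snd d\<bar> = int m}
      = (?s1 ` ?R \<union> ?s2 ` ?R) \<union> (?s3 ` ?R \<union> ?s4 ` ?R)" (is "?L = ?U")
  proof (rule set_eqI, clarify)
    fix a b
    have mem: "(a, b) \<in> ?s1 ` ?R \<longleftrightarrow> b = int m \<and> a \<in> ?R"
      "(a, b) \<in> ?s2 ` ?R \<longleftrightarrow> a = int m \<and> - b \<in> ?R"
      "(a, b) \<in> ?s3 ` ?R \<longleftrightarrow> b = - int m \<and> - a \<in> ?R"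
      "(a, b) \<in> ?s4 ` ?R \<longleftrightarrow> a = - int m \<and> b \<in> ?R"
      by force+
    have sides: "(a, b) \<in> ?s1 ` ?R \<longleftrightarrow> coprime a b \<and> b = int m \<and> - int m < a \<and> a \<le> int m"
      "(a, b) \<in> ?s2 ` ?R \<longleftrightarrow> coprime a b \<and> a = int m \<and> - int m \<le> b \<and> b < int m"
      "(a, b) \<in> ?s3 ` ?R \<longleftrightarrow> coprime a b \<and> b = - int m \<and> - int m \<le> a \<and> a < int m"
      "(a, b) \<in> ?s4 ` ?R \<longleftrightarrow> coprime a b \<and> a = - int m \<and> - int m < b \<and> b \<le> int m"
      unfolding mem by (auto simp: two_periods_def coprime_commute)
    have "max \<bar>a\<bar> \<bar>b\<bar> = int m \<longleftrightarrow>
        b = int m \<and> - int m < a \<and> a \<le> int m \<or> a = int m \<and> - int m \<le> b \<and> b < int m \<or>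
        b = - int m \<and> - int m \<le> a \<and> a < int m \<or> a = - int m \<and> - int m < b \<and> b \<le> int m"
      using assms(1) by linarith
    moreover have "(a, b) \<in> ?L \<longleftrightarrow> coprime a b \<and> max \<bar>a\<bar> \<bar>b\<bar> = int m"
      using assms(2) by (auto simp: primitive_dirs_def)
    ultimately show "(a, b) \<in> ?L \<longleftrightarrow> (a, b) \<in> ?U"
      by (simp only: Un_iff sides conj_disj_distribL disj_assoc)
  qed
  moreover have "?s1 ` ?R \<inter> ?s2 ` ?R = {}" "?s3 ` ?R \<inter> ?s4 ` ?R = {}"
    "(?s1 ` ?R \<union> ?s2 ` ?R) \<inter> (?s3 ` ?R \<union> ?s4 ` ?R) = {}"
    using assms by (auto simp: two_periods_def)
  ultimately show ?thesis
    by (simp add: card_Un_disjoint finite_two_periods card_image inj_on_def card_two_periods)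
qed

text \<open>The cut-off \<open>max 0\<close> removes every first coordinate of absolute value at
  least \<open>m\<close>, so each of the two horizontal lines reduces to a sum over
  \<open>two_periods m\<close>.\<close>

lemma sum_primitive_dirs_sides:
  assumes "m \<ge> 1" "m \<le> N"
  shows "(\<Sum>d | d \<in> primitive_dirs N \<and> \<bar>snd d\<bar> = int m. max 0 (int m - \<bar>fst d\<bar>))
       = 2 * int m * int (totient m)" (is "sum ?f ?L = _")
proof -
  let ?R = "two_periods m"
  let ?s1 = "\<lambda>a. (a, int m)" and ?s2 = "\<lambda>a. (a, - int m)"
  have fin: "finite ?L" using finite_primitive_dirs by simp
  have sub: "?s1 ` ?R \<union> ?s2 ` ?R \<subseteq> ?L"
    using assms by (auto simp: two_periods_def primitive_dirs_def)
  have rest: "?f d = 0" if "d \<in> ?L - (?s1 ` ?R \<union> ?s2 ` ?R)" for d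
  proof -
    obtain a b where d: "d = (a, b)" by (cases d)
    have b: "b = int m \<or> b = - int m" "coprime a b" using that d by (auto simp: primitive_dirs_def)
    then have "a \<notin> ?R" using that d by auto
    then show ?thesis using b d by (auto simp: two_periods_def)
  qed
  have "sum ?f ?L = sum ?f (?s1 ` ?R \<union> ?s2 ` ?R)"
    using rest by (intro sum.mono_neutral_right fin sub) blast
  also have "\<dots> = sum ?f (?s1 ` ?R) + sum ?f (?s2 ` ?R)"
    using assms by (intro sum.union_disjoint) (auto simp: finite_two_periods)
  also have "\<dots> = 2 * (\<Sum>a\<in>?R. max 0 (int m - \<bar>a\<bar>))"
    by (simp add: sum.reindex inj_on_def)
  also have "(\<Sum>a\<in>?R. max 0 (int m - \<bar>a\<bar>)) = (\<Sum>a\<in>?R. int m - \<bar>a\<bar>)"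
    by (rule sum.cong) (auto simp: two_periods_def)
  finally show ?thesis by (simp add: sum_two_periods_dist)
qed

section \<open>Difference identities and recurrences for weights\<close>

text \<open>The mixed difference of a product is the product of the first differences, and
  \<open>max 0 (n - x)\<close> exceeds its value at \<open>n - 1\<close> by 1 exactly when
  \<open>x < n\<close>.\<close>

lemma weight_square_diff:
  "weight r n n d - weight r (n - 1) n d - weight r n (n - 1) d + weight r (n - 1) (n - 1) d
   = of_bool (r * max \<bar>fst d\<bar> \<bar>snd d\<bar> < n)" if "r > 0"
proof -
  have "r * max \<bar>fst d\<bar> \<bar>snd d\<bar> = max (r * \<bar>fst d\<bar>) (r * \<bar>snd d\<bar>)"
    using that by (simp add: max_mult_distrib_left)
  moreover have "max 0 (n - x) * max 0 (n - y) - max 0 (n - 1 - x) * max 0 (n - y)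
      - max 0 (n - x) * max 0 (n - 1 - y) + max 0 (n - 1 - x) * max 0 (n - 1 - y)
      = of_bool (max x y < n)" for x y :: int
  proof -
    have P: "max 0 (n - z) = max 0 (n - 1 - z) + of_bool (z < n)" for z :: int by auto
    show ?thesis unfolding P[of x] P[of y] by (auto simp: algebra_simps)
  qed
  ultimately show ?thesis by (simp add: weight_def)
qed

text \<open>Terms sharing a factor at size \<open>n - 1\<close> combine into second differences of
  \<open>max 0 (n - z)\<close>, which vanish except at the kink \<open>z = n - 1\<close>.
  Symmetrising supplies one such pair per coordinate, and the two middle terms make up the
  coefficient 4.\<close>

lemma weight_offdiag_diff:
  fixes n r :: int
  shows "weight r (n - 1) n d + weight r n (n - 1) d - 4 * weight r (n - 1) (n - 1) d
     + weight r (n - 2) (n - 1) d + weight r (n - 1) (n - 2) d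
   = max 0 (n - 1 - r * \<bar>fst d\<bar>) * of_bool (r * \<bar>snd d\<bar> = n - 1)
     + max 0 (n - 1 - r * \<bar>snd d\<bar>) * of_bool (r * \<bar>fst d\<bar> = n - 1)"
proof -
  have P: "max 0 (n - z) + max 0 (n - 2 - z) = 2 * max 0 (n - 1 - z) + of_bool (z = n - 1)"
    for z :: int by (auto simp: max_def)
  define A B where "A = r * \<bar>fst d\<bar>" and "B = r * \<bar>snd d\<bar>"
  have "max 0 (n - 1 - A) * (max 0 (n - B) + max 0 (n - 2 - B))
      + max 0 (n - 1 - B) * (max 0 (n - A) + max 0 (n - 2 - A)) - 4 * (max 0 (n - 1 - A) * max 0 (n - 1 - B))
    = max 0 (n - 1 - A) * of_bool (B = n - 1) + max 0 (n - 1 - B) * of_bool (A = n - 1)"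
    unfolding P by (simp only: algebra_simps)
  then show ?thesis unfolding weight_def A_def[symmetric] B_def[symmetric]
    by (simp only: algebra_simps)
qed

text \<open>Solutions exist only if \<open>r\<close> divides \<open>n\<close>, and then fill the
  boundary of radius \<open>n div r\<close>. The argument \<open>n + 1\<close> offsets the
  \<open>n - 1\<close> inside \<open>e_fun\<close>.\<close>

lemma card_scaled_boundary:
  assumes "r \<ge> 1" "n \<ge> 1" "n \<le> N"
  shows "card {d \<in> primitive_dirs N. int r * max \<bar>fst d\<bar> \<bar>snd d\<bar> = int n} = 8 * e_fun r (n + 1)"
proof (cases "r dvd n")
  case True
  then obtain m where m: "n = r * m" by (elim dvdE)
  have "m \<le> r * m" using assms by simp
  then have "m \<le> N" using assms m by linarith
  moreover have "m \<ge> 1" using assms m by (cases m) auto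
  moreover have "int r * x = int n \<longleftrightarrow> x = int m" for x using assms m by simp
  ultimately show ?thesis using assms by (simp add: card_primitive_dirs_boundary e_fun_def m)
next
  case False
  then have "int r * x \<noteq> int n" for x by (metis dvd_triv_left int_dvd_int_iff)
  then show ?thesis using False by (simp add: e_fun_def)
qed

text \<open>Induction adds one boundary layer at a time: the layer at \<open>n\<close> is the
  summand \<open>i = n + 1\<close>. The base is empty because a primitive vector is nonzero.\<close>

lemma card_scaled_square:
  assumes "r \<ge> 1" "n \<ge> 1" "n \<le> N"
  shows "card {d \<in> primitive_dirs N. int r * max \<bar>fst d\<bar> \<bar>snd d\<bar> < int n} = 8 * (\<Sum>i=2..n. e_fun r i)"
  using assms(2,3)
proof (induction n rule: nat_induct_at_least)
  case base
  have "\<not> int r * max \<bar>a\<bar> \<bar>b\<bar> < 1" if "coprime a b" for a b :: int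
  proof -
    have "max \<bar>a\<bar> \<bar>b\<bar> \<ge> 1" using that by (cases "a = 0") auto
    then have "1 * 1 \<le> int r * max \<bar>a\<bar> \<bar>b\<bar>" using assms by (intro mult_mono) auto
    then show ?thesis by simp
  qed
  then have "{d \<in> primitive_dirs N. int r * max \<bar>fst d\<bar> \<bar>snd d\<bar> < int 1} = {}"
    by (auto simp: primitive_dirs_def)
  then show ?case by (simp only: card.empty) simp
next
  case (Suc n)
  let ?m = "\<lambda>d. int r * max \<bar>fst d\<bar> \<bar>snd d\<bar>"
  have "{d \<in> primitive_dirs N. ?m d < int (Suc n)}
      = {d \<in> primitive_dirs N. ?m d < int n} \<union> {d \<in> primitive_dirs N. ?m d = int n}" by auto
  moreover have "{d \<in> primitive_dirs N. ?m d < int n} \<inter> {d \<in> primitive_dirs N. ?m d = int n} = {}"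
    by auto
  ultimately show ?case
    using Suc card_scaled_boundary[OF assms(1), of n N] finite_primitive_dirs
    by (simp add: card_Un_disjoint)
qed

text \<open>The two off-diagonal sums agree by symmetry. The factor 2 is kept apart on the right to
  match the doubled line counts.\<close>

lemma weight_sum_square_rec:
  assumes "r \<ge> 1" "n \<ge> 1" "n \<le> N"
  shows "weight_sum N (int r) (int n) (int n) - 2 * weight_sum N (int r) (int n - 1) (int n)
      + weight_sum N (int r) (int n - 1) (int n - 1) = 2 * (4 * (\<Sum>i=2..n. int (e_fun r i)))"
proof -
  have "weight_sum N (int r) (int n) (int n) - weight_sum N (int r) (int n - 1) (int n)
      - weight_sum N (int r) (int n) (int n - 1) + weight_sum N (int r) (int n - 1) (int n - 1)
    = (\<Sum>d\<in>primitive_dirs N. of_bool (int r * max \<bar>fst d\<bar> \<bar>snd d\<bar> < int n))"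
    unfolding weight_sum_def sum_subtractf[symmetric] sum.distrib[symmetric]
    using assms by (simp add: weight_square_diff)
  also have "\<dots> = int (card {d \<in> primitive_dirs N. int r * max \<bar>fst d\<bar> \<bar>snd d\<bar> < int n})"
    using finite_primitive_dirs by (simp add: of_bool_def sum.If_cases Int_def)
  also have "\<dots> = 8 * (\<Sum>i=2..n. int (e_fun r i))"
    using card_scaled_square[OF assms] by simp
  finally show ?thesis using weight_sum_commute[of N "int r" "int n" "int n - 1"] by simp
qed

text \<open>The symmetrised identity is summed: swapping coordinates merges the two boundary sums,
  and commutativity of \<open>weight_sum\<close> merges the terms on the left, so a factor 2
  cancels.\<close>

lemma weight_sum_offdiag_rec:
  assumes "r \<ge> 1" "n \<ge> 2" "n \<le> N"
  shows "weight_sum N (int r) (int n - 1) (int n) - 2 * weight_sum N (int r) (int n - 1) (int n - 1)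
      + weight_sum N (int r) (int n - 2) (int n - 1) = 2 * ((int n - 1) * int (e_fun r n))"
proof -
  let ?g = "\<lambda>d. max 0 (int n - 1 - int r * \<bar>fst d\<bar>) * of_bool (int r * \<bar>snd d\<bar> = int n - 1)"
  have "weight_sum N (int r) (int n - 1) (int n) + weight_sum N (int r) (int n) (int n - 1)
      - 4 * weight_sum N (int r) (int n - 1) (int n - 1)
      + weight_sum N (int r) (int n - 2) (int n - 1) + weight_sum N (int r) (int n - 1) (int n - 2)
    = (\<Sum>d\<in>primitive_dirs N. ?g d + ?g (snd d, fst d))"
    unfolding weight_sum_def sum_distrib_left sum_subtractf[symmetric] sum.distrib[symmetric]
      weight_offdiag_diff by (simp only: fst_conv snd_conv)
  also have "\<dots> = 2 * (\<Sum>d\<in>primitive_dirs N. ?g d)"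
    unfolding sum.distrib primitive_dirs_swap[of ?g] by simp
  also have "(\<Sum>d\<in>primitive_dirs N. ?g d) = 2 * ((int n - 1) * int (e_fun r n))"
  proof (cases "r dvd n - 1")
    case True
    \<comment> \<open>With \<open>n - 1 = r * m\<close> the factor \<open>r\<close> cancels from the
      side condition and comes out of the cut-off, leaving two sides of the square of radius
      \<open>m\<close>.\<close>
    then obtain m where m: "n - 1 = r * m" by (elim dvdE)
    have "m \<le> r * m" using assms by simp
    then have "m \<le> N" using assms m by linarith
    moreover have "m \<ge> 1" using m assms(2) by (cases m) simp_all
    ultimately have mN: "m \<ge> 1" "m \<le> N" by simp_all
    have n1: "int n - 1 = int r * int m" using m assms(2) by (simp flip: of_nat_mult)
    have r: "int r * x = int r * int m \<longleftrightarrow> x = int m" for x using assms by simp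
    have mx: "max 0 (int r * int m - int r * x) = int r * max 0 (int m - x)" for x
      using assms by (simp add: max_mult_distrib_left right_diff_distrib)
    have "(\<Sum>d\<in>primitive_dirs N. ?g d)
        = (\<Sum>d\<in>primitive_dirs N. if \<bar>snd d\<bar> = int m then int r * max 0 (int m - \<bar>fst d\<bar>) else 0)"
      unfolding n1 r mx by (rule sum.cong) auto
    also have "\<dots> = (\<Sum>d | d \<in> primitive_dirs N \<and> \<bar>snd d\<bar> = int m. int r * max 0 (int m - \<bar>fst d\<bar>))"
      using finite_primitive_dirs by (simp add: sum.inter_filter)
    also have "\<dots> = int r * (2 * int m * int (totient m))"
      unfolding sum_distrib_left[symmetric] sum_primitive_dirs_sides[OF mN] ..
    also have "totient m = e_fun r n" using assms(1) m by (simp add: e_fun_def)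
    finally show ?thesis unfolding n1 by simp
  next
    case False
    have "int r * x \<noteq> int n - 1" for x
    proof
      assume "int r * x = int n - 1"
      then have "int r dvd int (n - 1)" using assms(2) by (metis One_nat_def dvd_triv_left
            int_ops(6) int_ops(2) le_trans one_le_numeral not_less of_nat_less_iff)
      then show False using False by simp
    qed
    then show ?thesis using False by (simp add: e_fun_def)
  qed
  finally show ?thesis
    using weight_sum_commute[of N "int r" "int n" "int n - 1"]
      weight_sum_commute[of N "int r" "int n - 2" "int n - 1"] by simp
qed

section \<open>Initial values\<close>

text \<open>Some coordinate of a primitive vector is nonzero, and \<open>r\<close> times its
  absolute value already reaches the side length.\<close>

lemma weight_eq_0:
  assumes "coprime (fst d) (snd d)" "r \<ge> 0" "m1 \<le> r" "m2 \<le> r"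
  shows "weight r m1 m2 d = 0"
proof -
  have *: "r \<le> r * \<bar>x\<bar>" if "x \<noteq> 0" for x using that assms(2) mult_left_mono[of 1 "\<bar>x\<bar>" r] by simp
  have "fst d \<noteq> 0 \<or> snd d \<noteq> 0" using assms(1) by auto
  then show ?thesis using *[of "fst d"] *[of "snd d"] assms(3,4) by (auto simp: weight_def)
qed

lemma weight_sum_eq_0:
  assumes "r \<ge> 0" "m1 \<le> r" "m2 \<le> r"
  shows "weight_sum N r m1 m2 = 0"
  unfolding weight_sum_def
  by (rule sum.neutral) (auto simp: primitive_dirs_def intro!: weight_eq_0 assms)

text \<open>Both sides are at most \<open>q - 1\<close>, so all three weight sums vanish.\<close>

lemma num_lines_eq_0:
  assumes "q \<ge> 2" "n1 < q" "n2 < q"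
  shows "num_lines q n1 n2 = 0"
  using two_num_lines[OF assms(1), of n1 "max n1 n2" n2] assms by (simp add: weight_sum_eq_0)

text \<open>Only \<open>r = q - 1\<close> contributes, and there only the vertical vectors
  \<open>(0, 1)\<close> and \<open>(0, -1)\<close>, each of weight
  \<open>(q - 1) * 1\<close>.\<close>

lemma num_lines_pred_self:
  assumes "q \<ge> 2"
  shows "num_lines q (q - 1) q = q - 1"
proof -
  let ?r = "int (q - 1)"
  have q: "int q = ?r + 1" "?r \<ge> 1" using assms by simp_all
  have "weight_sum q ?r ?r (int q) = (\<Sum>d\<in>{(0, 1), (0, -1)}. weight ?r ?r (int q) d)"
    unfolding weight_sum_def
  proof (rule sum.mono_neutral_right[OF finite_primitive_dirs])
    show "{(0, 1), (0, -1)} \<subseteq> primitive_dirs q" using assms by (auto simp: primitive_dirs_def)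
    show "\<forall>d\<in>primitive_dirs q - {(0, 1), (0, -1)}. weight ?r ?r (int q) d = 0"
    proof
      fix d assume d: "d \<in> primitive_dirs q - {(0, 1), (0, -1)}"
      have "fst d \<noteq> 0"
      proof
        assume "fst d = 0"
        then have "\<bar>snd d\<bar> = 1" using d by (auto simp: primitive_dirs_def)
        then show False using d \<open>fst d = 0\<close> by (cases d) (auto simp: abs_if split: if_splits)
      qed
      then have "?r \<le> ?r * \<bar>fst d\<bar>" using mult_left_mono[of 1 "\<bar>fst d\<bar>" ?r] by simp
      then show "weight ?r ?r (int q) d = 0" by (simp add: weight_def)
    qed
  qed
  also have "\<dots> = 2 * ?r" using q by (simp add: weight_def)
  finally have "2 * int (num_lines q (q - 1) q) = 2 * ?r"
    using two_num_lines[OF assms, of "q - 1" q q] by (simp add: weight_sum_eq_0)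
  then show ?thesis by simp
qed

section \<open>Assembling the recurrences\<close>

theorem corollary4:
  fixes n q :: nat
  assumes "n \<ge> 2" and "q \<ge> 2"
  shows "int (num_lines_sq q n)
           = 2 * int (num_lines q (n - 1) n) - int (num_lines_sq q (n - 1)) + rho_q q n
       \<and> int (num_lines q (n - 1) n)
           = 2 * int (num_lines_sq q (n - 1)) - int (num_lines q (n - 2) (n - 1)) + sigma_q q n
       \<and> rho_q q n - rho_q q (n - 1)
           = 4 * (int (e_fun (q - 1) n) - 2 * int (e_fun q n) + int (e_fun (q + 1) n))
       \<and> (\<forall>m. 1 \<le> m \<and> m < q \<longrightarrow> num_lines_sq q m = 0 \<and> num_lines q (m - 1) m = 0)
       \<and> num_lines q (q - 1) q = q - 1"
proof (intro conjI)
  have n: "int (n - 1) = int n - 1" "int (n - 2) = int n - 2" using assms(1) by auto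
  have le: "n \<le> n" "n - 1 \<le> n" "n - 2 \<le> n" by simp_all
  \<comment> \<open>All grids in both recurrences have sides at most \<open>n\<close>, so their sums
    share one set of directions.\<close>
  note two = two_num_lines[OF assms(2), where N = n]
  have q: "q - 1 \<ge> 1" "q \<ge> 1" "q + 1 \<ge> 1" using assms(2) by auto
  have n1: "n \<ge> 1" using assms(1) by simp
  \<comment> \<open>The second difference in \<open>r\<close> commutes with the linear combination
    of grid sizes, so the weight recurrences for \<open>r = q - 1\<close>, \<open>q\<close>,
    \<open>q + 1\<close> transfer to line counts.\<close>
  have combine: "A = 2 * B - C + (x1 - 2 * x2 + x3)"
    if "2 * A = a1 - 2 * a2 + a3" "2 * B = b1 - 2 * b2 + b3" "2 * C = c1 - 2 * c2 + c3"
      "a1 - 2 * b1 + c1 = 2 * x1" "a2 - 2 * b2 + c2 = 2 * x2" "a3 - 2 * b3 + c3 = 2 * x3"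
    for A B C a1 a2 a3 b1 b2 b3 c1 c2 c3 x1 x2 x3 :: int
    using that by linarith
  have rho: "rho_q q n = 4 * (\<Sum>i=2..n. int (e_fun (q - 1) i)) - 2 * (4 * (\<Sum>i=2..n. int (e_fun q i)))
      + 4 * (\<Sum>i=2..n. int (e_fun (q + 1) i))"
    by (simp add: rho_q_def sum.distrib sum_subtractf sum_distrib_left)
  show "int (num_lines_sq q n)
      = 2 * int (num_lines q (n - 1) n) - int (num_lines_sq q (n - 1)) + rho_q q n"
    unfolding rho
    by (rule combine[OF two[OF le(1) le(1)] two[OF le(2) le(1), unfolded n] two[OF le(2) le(2), unfolded n]
        q[THEN weight_sum_square_rec[OF _ n1 order_refl]]])
  have sigma: "sigma_q q n = (int n - 1) * int (e_fun (q - 1) n)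
      - 2 * ((int n - 1) * int (e_fun q n)) + (int n - 1) * int (e_fun (q + 1) n)"
    by (simp add: sigma_q_def algebra_simps)
  show "int (num_lines q (n - 1) n)
      = 2 * int (num_lines_sq q (n - 1)) - int (num_lines q (n - 2) (n - 1)) + sigma_q q n"
    unfolding sigma
    by (rule combine[OF two[OF le(2) le(1), unfolded n] two[OF le(2) le(2), unfolded n]
        two[OF le(3) le(2), unfolded n] q[THEN weight_sum_offdiag_rec[OF _ assms(1) order_refl]]])
  \<comment> \<open>In this form the sum in \<open>rho_q\<close> splits off its last term;
    \<open>k \<ge> 1\<close> ensures that the range from 2 reaches it.\<close>
  obtain k where "n = Suc k" "k \<ge> 1" using assms(1) by (cases n) auto
  then show "rho_q q n - rho_q q (n - 1)
      = 4 * (int (e_fun (q - 1) n) - 2 * int (e_fun q n) + int (e_fun (q + 1) n))"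
    by (simp add: rho_q_def)
  show "\<forall>m. 1 \<le> m \<and> m < q \<longrightarrow> num_lines_sq q m = 0 \<and> num_lines q (m - 1) m = 0"
    using assms(2) by (auto intro!: num_lines_eq_0)
  show "num_lines q (q - 1) q = q - 1" using assms(2) by (rule num_lines_pred_self)
qed

end
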